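(* Let $R$ be a quasiorder on $U$ and let $S$ be the set of $R$-closed elements of $U$. Then $\cong_S$ is a Boolean congruence on the Heyting algebra $\mathcal{T}_R(U)$, and \[ \mathit{DRS}_R(U)=N_{\cong_S}(\mathcal{T}_R(U)). \]
   Context: A quasiorder on $U$ is a reflexive and transitive binary relation $R$ on $U$. Put $R(x)=\{y\in U\mid x\,R\,y\}$, and for $X\subseteq U$ let $X_R=\{x\in U\mid R(x)\subseteq X\}$, $X^R=\{x\in U\mid R(x)\cap X\neq\emptyset\}$, and $-X=U\setminus X$. An element $x\in U$ is $R$-closed if $R(x)=\{x\}$. $\mathit{DRS}_R(U)=\{(X_R,-X^R)\mid X\subseteq U\}$. $\mathcal{T}_R(U)=\{X_R\mid X\subseteq U\}$, which under inclusion is a Heyting algebra $(\mathcal{T}_R(U),\cup,\cap,\Rightarrow,\emptyset,U)$ with $X\Rightarrow Y=(-X\cup Y)_R$. The relation $\cong_S$ on $\mathcal{T}_R(U)$ is given by $X\cong_S Y$ iff $X\cap S=Y\cap S$. A congruence on a Heyting algebra (compatible with $\vee,\wedge,\Rightarrow$) is Boolean if its quotient is a Boolean algebra. For a Heyting algebra $H$ and a Boolean congruence $\Theta$ on $H$, Sendlewski's construction is $N_\Theta(H)=\{(a,b)\in H\times H\mid a\wedge b=0\text{ and }(a\vee b)\,\Theta\,1\}$. *)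

theory Defs
  imports Main
begin

section \<open>Heyting algebras on a carrier set, congruences and quotients\<close>

record 'a heyting_sig =
  hcarrier :: "'a set"
  hjoin :: "'a \<Rightarrow> 'a \<Rightarrow> 'a"
  hmeet :: "'a \<Rightarrow> 'a \<Rightarrow> 'a"
  himp :: "'a \<Rightarrow> 'a \<Rightarrow> 'a"
  hbot :: 'a
  htop :: 'a

definition hle :: "('a, 'm) heyting_sig_scheme \<Rightarrow> 'a \<Rightarrow> 'a \<Rightarrow> bool" where
  "hle H a b \<longleftrightarrow> hmeet H a b = a"

text \<open>Distributivity is not listed: it follows from residuation.\<close>

locale heyting_alg =
  fixes H :: "('a, 'm) heyting_sig_scheme"
  assumes join_closed: "a \<in> hcarrier H \<Longrightarrow> b \<in> hcarrier H \<Longrightarrow> hjoin H a b \<in> hcarrier H"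
    and meet_closed: "a \<in> hcarrier H \<Longrightarrow> b \<in> hcarrier H \<Longrightarrow> hmeet H a b \<in> hcarrier H"
    and imp_closed: "a \<in> hcarrier H \<Longrightarrow> b \<in> hcarrier H \<Longrightarrow> himp H a b \<in> hcarrier H"
    and bot_closed: "hbot H \<in> hcarrier H"
    and top_closed: "htop H \<in> hcarrier H"
    and join_assoc: "a \<in> hcarrier H \<Longrightarrow> b \<in> hcarrier H \<Longrightarrow> c \<in> hcarrier H \<Longrightarrow>
      hjoin H (hjoin H a b) c = hjoin H a (hjoin H b c)"
    and meet_assoc: "a \<in> hcarrier H \<Longrightarrow> b \<in> hcarrier H \<Longrightarrow> c \<in> hcarrier H \<Longrightarrow>
      hmeet H (hmeet H a b) c = hmeet H a (hmeet H b c)"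
    and join_commute: "a \<in> hcarrier H \<Longrightarrow> b \<in> hcarrier H \<Longrightarrow> hjoin H a b = hjoin H b a"
    and meet_commute: "a \<in> hcarrier H \<Longrightarrow> b \<in> hcarrier H \<Longrightarrow> hmeet H a b = hmeet H b a"
    and join_absorb: "a \<in> hcarrier H \<Longrightarrow> b \<in> hcarrier H \<Longrightarrow> hjoin H a (hmeet H a b) = a"
    and meet_absorb: "a \<in> hcarrier H \<Longrightarrow> b \<in> hcarrier H \<Longrightarrow> hmeet H a (hjoin H a b) = a"
    and bot_least: "a \<in> hcarrier H \<Longrightarrow> hle H (hbot H) a"
    and top_greatest: "a \<in> hcarrier H \<Longrightarrow> hle H a (htop H)"
    and residuation: "a \<in> hcarrier H \<Longrightarrow> b \<in> hcarrier H \<Longrightarrow> c \<in> hcarrier H \<Longrightarrow>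
      hle H c (himp H a b) \<longleftrightarrow> hle H (hmeet H c a) b"

text \<open>The one-element algebra (bottom = top) counts as Boolean; it does occur as a quotient
  below, namely when there are no closed elements.\<close>

locale boolean_alg = heyting_alg +
  assumes complemented: "a \<in> hcarrier H \<Longrightarrow>
    \<exists>c\<in>hcarrier H. hmeet H a c = hbot H \<and> hjoin H a c = htop H"

locale heyting_congruence = heyting_alg H
  for H :: "('a, 'm) heyting_sig_scheme" +
  fixes \<Theta> :: "('a \<times> 'a) set"
  assumes equiv: "equiv (hcarrier H) \<Theta>"
    and join_compat: "(a, a') \<in> \<Theta> \<Longrightarrow> (b, b') \<in> \<Theta> \<Longrightarrow> (hjoin H a b, hjoin H a' b') \<in> \<Theta>"
    and meet_compat: "(a, a') \<in> \<Theta> \<Longrightarrow> (b, b') \<in> \<Theta> \<Longrightarrow> (hmeet H a b, hmeet H a' b') \<in> \<Theta>"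
    and imp_compat: "(a, a') \<in> \<Theta> \<Longrightarrow> (b, b') \<in> \<Theta> \<Longrightarrow> (himp H a b, himp H a' b') \<in> \<Theta>"

text \<open>For a congruence, the unions below run over copies of one and the same class.\<close>

definition quotient_op :: "('a \<times> 'a) set \<Rightarrow> ('a \<Rightarrow> 'a \<Rightarrow> 'a) \<Rightarrow> 'a set \<Rightarrow> 'a set \<Rightarrow> 'a set" where
  "quotient_op \<Theta> f A B = (\<Union>a\<in>A. \<Union>b\<in>B. \<Theta> `` {f a b})"

definition heyting_quotient ::
  "('a, 'm) heyting_sig_scheme \<Rightarrow> ('a \<times> 'a) set \<Rightarrow> 'a set heyting_sig" where
  "heyting_quotient H \<Theta> =
    \<lparr>hcarrier = hcarrier H // \<Theta>,
     hjoin = quotient_op \<Theta> (hjoin H),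
     hmeet = quotient_op \<Theta> (hmeet H),
     himp = quotient_op \<Theta> (himp H),
     hbot = \<Theta> `` {hbot H},
     htop = \<Theta> `` {htop H}\<rparr>"

locale boolean_congruence = heyting_congruence +
  assumes boolean_quotient: "boolean_alg (heyting_quotient H \<Theta>)"

definition sendlewski :: "('a, 'm) heyting_sig_scheme \<Rightarrow> ('a \<times> 'a) set \<Rightarrow> ('a \<times> 'a) set" where
  "sendlewski H \<Theta> =
    {(a, b) \<in> hcarrier H \<times> hcarrier H. hmeet H a b = hbot H \<and> (hjoin H a b, htop H) \<in> \<Theta>}"

section \<open>Rough approximations\<close>

definition lower :: "'a set \<Rightarrow> 'a rel \<Rightarrow> 'a set \<Rightarrow> 'a set" where
  "lower U R X = {x \<in> U. R `` {x} \<subseteq> X}"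

definition upper :: "'a set \<Rightarrow> 'a rel \<Rightarrow> 'a set \<Rightarrow> 'a set" where
  "upper U R X = {x \<in> U. R `` {x} \<inter> X \<noteq> {}}"

definition closed_elems :: "'a set \<Rightarrow> 'a rel \<Rightarrow> 'a set" where
  "closed_elems U R = {x \<in> U. R `` {x} = {x}}"

definition DRS :: "'a set \<Rightarrow> 'a rel \<Rightarrow> ('a set \<times> 'a set) set" where
  "DRS U R = {(lower U R X, U - upper U R X) | X. X \<subseteq> U}"

definition lower_algebra :: "'a set \<Rightarrow> 'a rel \<Rightarrow> 'a set heyting_sig" where
  "lower_algebra U R =
    \<lparr>hcarrier = {lower U R X | X. X \<subseteq> U},
     hjoin = (\<union>),
     hmeet = (\<inter>),
     himp = (\<lambda>X Y. lower U R ((U - X) \<union> Y)),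
     hbot = {},
     htop = U\<rparr>"

definition cong_on :: "'a set \<Rightarrow> 'a rel \<Rightarrow> 'a set \<Rightarrow> ('a set \<times> 'a set) set" where
  "cong_on U R S =
    {(X, Y) \<in> hcarrier (lower_algebra U R) \<times> hcarrier (lower_algebra U R). X \<inter> S = Y \<inter> S}"

end

(* The inclusion of N(T_R(U)) in DRS_R(U) needs a set X with lower approximation A and
   -(upper approximation) B, for disjoint R-up-sets A and B that cover the R-closed elements.
   Let W be the complement of A and B in U, and say that x sees y if y is in R(x).
   Every x in W must see an element of X and one outside X. The elements of W that see no
   element of A or B form an up-set without R-closed elements, and it splits into two parts
   such that each of its elements sees both parts (by Zorn's lemma, as in the resolution of
   spaces without isolated points). One of the parts is put into X.
   The other elements of W see A or B; those that see B but not A are put into X, and the rest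
   are left out. *)

theory Submission
  imports Defs
begin

section \<open>Quotients of Heyting algebras\<close>

context heyting_alg
begin

lemma meet_idem:
  assumes "a \<in> hcarrier H"
  shows "hmeet H a a = a"
  using assms join_absorb meet_absorb meet_closed by metis

lemma le_trans:
  assumes "a \<in> hcarrier H" "b \<in> hcarrier H" "c \<in> hcarrier H" "hle H a b" "hle H b c"
  shows "hle H a c"
  using assms unfolding hle_def by (metis meet_assoc)

lemma le_antisym:
  assumes "a \<in> hcarrier H" "b \<in> hcarrier H" "hle H a b" "hle H b a"
  shows "a = b"
  using assms unfolding hle_def by (metis meet_commute)

lemma le_meet_iff:
  assumes "a \<in> hcarrier H" "b \<in> hcarrier H" "c \<in> hcarrier H"
  shows "hle H a (hmeet H b c) \<longleftrightarrow> hle H a b \<and> hle H a c"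
  using assms unfolding hle_def
  by (smt (verit, ccfv_threshold) meet_assoc meet_closed meet_commute meet_idem)

lemma meet_le1:
  assumes "a \<in> hcarrier H" "b \<in> hcarrier H"
  shows "hle H (hmeet H a b) a"
  using assms unfolding hle_def by (metis meet_assoc meet_commute meet_closed meet_idem)

lemma meet_le2:
  assumes "a \<in> hcarrier H" "b \<in> hcarrier H"
  shows "hle H (hmeet H a b) b"
  using assms unfolding hle_def by (metis meet_assoc meet_idem)

text \<open>Take \<open>d\<close> to be \<open>a\<close>, then \<open>b\<close>. Equations that
  involve \<open>himp\<close> thereby come within reach of residuation.\<close>

lemma eq_if_same_lower_bounds:
  assumes "a \<in> hcarrier H" "b \<in> hcarrier H"
    and "\<And>d. d \<in> hcarrier H \<Longrightarrow> hle H d a \<longleftrightarrow> hle H d b"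
  shows "a = b"
  using assms by (metis hle_def le_antisym meet_idem)

lemma meet_imp:
  assumes a: "a \<in> hcarrier H" and b: "b \<in> hcarrier H"
  shows "hmeet H a (himp H a b) = hmeet H a b"
proof (rule eq_if_same_lower_bounds)
  fix d assume d: "d \<in> hcarrier H"
  have "hle H d (himp H a b) \<longleftrightarrow> hle H d b" if "hle H d a"
    using that residuation[OF a b d] by (simp add: hle_def)
  then show "hle H d (hmeet H a (himp H a b)) \<longleftrightarrow> hle H d (hmeet H a b)"
    using a b d by (auto simp: le_meet_iff imp_closed)
qed (use a b in \<open>auto simp: meet_closed imp_closed\<close>)

text \<open>If \<open>d\<close> is below \<open>c\<close>, then the meet of \<open>d\<close> and
  \<open>a\<close> is below the meet of \<open>c\<close> and \<open>a\<close> anyway, so after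
  residuation the extra factor imposes nothing new.\<close>

lemma meet_imp_meet:
  assumes a: "a \<in> hcarrier H" and b: "b \<in> hcarrier H" and c: "c \<in> hcarrier H"
  shows "hmeet H c (himp H a (hmeet H (hmeet H c a) b)) = hmeet H c (himp H a b)"
proof (rule eq_if_same_lower_bounds)
  fix d assume d: "d \<in> hcarrier H"
  have ca: "hmeet H c a \<in> hcarrier H" and da: "hmeet H d a \<in> hcarrier H"
    and cab: "hmeet H (hmeet H c a) b \<in> hcarrier H"
    using a b c d by (simp_all add: meet_closed)
  have "hle H (hmeet H d a) (hmeet H (hmeet H c a) b) \<longleftrightarrow> hle H (hmeet H d a) b"
    if "hle H d c"
    using that a b c d ca da le_meet_iff meet_le1 meet_le2 le_trans by metis
  then show "hle H d (hmeet H c (himp H a (hmeet H (hmeet H c a) b)))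
      \<longleftrightarrow> hle H d (hmeet H c (himp H a b))"
    using a b c d cab residuation[OF a b d] residuation[OF a cab d]
    by (auto simp: le_meet_iff imp_closed)
qed (use a b c in \<open>auto simp: meet_closed imp_closed\<close>)

end

section \<open>Congruences and the quotient algebra\<close>

context heyting_congruence
begin

lemma quotient_op_class:
  assumes "\<And>x x' y y'. (x, x') \<in> \<Theta> \<Longrightarrow> (y, y') \<in> \<Theta> \<Longrightarrow> (f x y, f x' y') \<in> \<Theta>"
    and "a \<in> hcarrier H" "b \<in> hcarrier H"
  shows "quotient_op \<Theta> f (\<Theta> `` {a}) (\<Theta> `` {b}) = \<Theta> `` {f a b}"
proof -
  have "\<Theta> `` {f x y} = \<Theta> `` {f a b}" if "x \<in> \<Theta> `` {a}" "y \<in> \<Theta> `` {b}" for x y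
    using that assms(1) equiv_class_eq[OF equiv] by blast
  moreover have "a \<in> \<Theta> `` {a}" "b \<in> \<Theta> `` {b}"
    using assms equiv_class_self[OF equiv] by auto
  ultimately show ?thesis
    unfolding quotient_op_def by blast
qed

lemma class_eq_iff:
  assumes "a \<in> hcarrier H" "b \<in> hcarrier H"
  shows "\<Theta> `` {a} = \<Theta> `` {b} \<longleftrightarrow> (a, b) \<in> \<Theta>"
  using assms eq_equiv_class_iff[OF equiv] by blast

lemma cong_refl: "a \<in> hcarrier H \<Longrightarrow> (a, a) \<in> \<Theta>"
  using class_eq_iff by blast

text \<open>This is residuation for classes, with each inequality written as the equation that
  defines \<open>hle\<close>. From left to right, meet with \<open>a\<close>; from right to left,
  apply \<open>himp H a\<close> and then meet with \<open>c\<close>.\<close>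

lemma cong_meet_imp_iff:
  assumes a: "a \<in> hcarrier H" and b: "b \<in> hcarrier H" and c: "c \<in> hcarrier H"
  shows "(hmeet H c (himp H a b), c) \<in> \<Theta> \<longleftrightarrow> (hmeet H (hmeet H c a) b, hmeet H c a) \<in> \<Theta>"
proof
  have ab: "himp H a b \<in> hcarrier H" and ca: "hmeet H c a \<in> hcarrier H"
    using a b c by (simp_all add: imp_closed meet_closed)
  show "(hmeet H (hmeet H c a) b, hmeet H c a) \<in> \<Theta>" if "(hmeet H c (himp H a b), c) \<in> \<Theta>"
  proof -
    have "hmeet H (hmeet H c (himp H a b)) a = hmeet H (hmeet H c a) b"
      using a b c ab by (metis meet_assoc meet_commute meet_imp)
    then show ?thesis
      using meet_compat[OF that cong_refl[OF a]] by simp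
  qed
  show "(hmeet H c (himp H a b), c) \<in> \<Theta>" if "(hmeet H (hmeet H c a) b, hmeet H c a) \<in> \<Theta>"
  proof -
    have "hle H c (himp H a (hmeet H c a))"
      using residuation[OF a ca c] ca by (simp add: hle_def meet_idem)
    then have "hmeet H c (himp H a (hmeet H c a)) = c"
      by (simp add: hle_def)
    then show ?thesis
      using meet_compat[OF cong_refl[OF c] imp_compat[OF cong_refl[OF a] that]] a b c
      by (simp add: meet_imp_meet)
  qed
qed

text \<open>Closure and equations pass to classes through representatives. Residuation is an
  equivalence of two equations, which need not survive a quotient; \<open>cong_meet_imp_iff\<close>
  supplies it.\<close>

lemma heyting_alg_quotient: "heyting_alg (heyting_quotient H \<Theta>)"
proof -
  let ?Q = "heyting_quotient H \<Theta>"
  have carrier: "hcarrier ?Q = (\<lambda>a. \<Theta> `` {a}) ` hcarrier H"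
    by (auto simp: heyting_quotient_def quotient_def)
  have ops: "hjoin ?Q (\<Theta> `` {a}) (\<Theta> `` {b}) = \<Theta> `` {hjoin H a b}"
    "hmeet ?Q (\<Theta> `` {a}) (\<Theta> `` {b}) = \<Theta> `` {hmeet H a b}"
    "himp ?Q (\<Theta> `` {a}) (\<Theta> `` {b}) = \<Theta> `` {himp H a b}"
    if "a \<in> hcarrier H" "b \<in> hcarrier H" for a b
    using that by (simp_all add: heyting_quotient_def quotient_op_class
        join_compat meet_compat imp_compat)
  have bounds: "hbot ?Q = \<Theta> `` {hbot H}" "htop ?Q = \<Theta> `` {htop H}"
    by (simp_all add: heyting_quotient_def)
  note closed = join_closed meet_closed imp_closed bot_closed top_closed
  show ?thesis
  proof (unfold_locales, unfold carrier bounds)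
    fix A B C assume "A \<in> (\<lambda>a. \<Theta> `` {a}) ` hcarrier H" "B \<in> (\<lambda>a. \<Theta> `` {a}) ` hcarrier H"
    then obtain a b where ab: "a \<in> hcarrier H" "A = \<Theta> `` {a}" "b \<in> hcarrier H" "B = \<Theta> `` {b}"
      by blast
    show "hjoin ?Q A B \<in> (\<lambda>a. \<Theta> `` {a}) ` hcarrier H"
      "hmeet ?Q A B \<in> (\<lambda>a. \<Theta> `` {a}) ` hcarrier H"
      "himp ?Q A B \<in> (\<lambda>a. \<Theta> `` {a}) ` hcarrier H"
      using ab by (simp_all add: ops closed)
    show "hjoin ?Q A B = hjoin ?Q B A" "hmeet ?Q A B = hmeet ?Q B A"
      using ab join_commute[of a b] meet_commute[of a b] by (simp_all add: ops)
    show "hjoin ?Q A (hmeet ?Q A B) = A" "hmeet ?Q A (hjoin ?Q A B) = A"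
      using ab by (simp_all add: ops closed join_absorb meet_absorb)
    assume "C \<in> (\<lambda>a. \<Theta> `` {a}) ` hcarrier H"
    then obtain c where c: "c \<in> hcarrier H" "C = \<Theta> `` {c}"
      by blast
    show "hjoin ?Q (hjoin ?Q A B) C = hjoin ?Q A (hjoin ?Q B C)"
      "hmeet ?Q (hmeet ?Q A B) C = hmeet ?Q A (hmeet ?Q B C)"
      using ab c by (simp_all add: ops closed join_assoc meet_assoc)
    show "hle ?Q C (himp ?Q A B) \<longleftrightarrow> hle ?Q (hmeet ?Q C A) B"
      using ab c by (simp add: hle_def ops closed class_eq_iff cong_meet_imp_iff)
  next
    fix A assume "A \<in> (\<lambda>a. \<Theta> `` {a}) ` hcarrier H"
    then show "hle ?Q (\<Theta> `` {hbot H}) A" "hle ?Q A (\<Theta> `` {htop H})"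
      using bot_least top_greatest by (auto simp: hle_def ops closed)
  qed (simp_all add: closed)
qed

lemma boolean_congruenceI:
  assumes "\<And>a. a \<in> hcarrier H \<Longrightarrow>
    \<exists>c\<in>hcarrier H. (hmeet H a c, hbot H) \<in> \<Theta> \<and> (hjoin H a c, htop H) \<in> \<Theta>"
  shows "boolean_congruence H \<Theta>"
proof -
  interpret Q: heyting_alg "heyting_quotient H \<Theta>"
    by (rule heyting_alg_quotient)
  show ?thesis
  proof unfold_locales
    fix A assume "A \<in> hcarrier (heyting_quotient H \<Theta>)"
    then obtain a where a: "a \<in> hcarrier H" "A = \<Theta> `` {a}"
      by (auto simp: heyting_quotient_def elim: quotientE)
    then obtain c where c: "c \<in> hcarrier H" "(hmeet H a c, hbot H) \<in> \<Theta>" "(hjoin H a c, htop H) \<in> \<Theta>"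
      using assms by blast
    show "\<exists>C\<in>hcarrier (heyting_quotient H \<Theta>).
        hmeet (heyting_quotient H \<Theta>) A C = hbot (heyting_quotient H \<Theta>) \<and>
        hjoin (heyting_quotient H \<Theta>) A C = htop (heyting_quotient H \<Theta>)"
    proof (intro bexI conjI)
      show "hmeet (heyting_quotient H \<Theta>) A (\<Theta> `` {c}) = hbot (heyting_quotient H \<Theta>)"
        "hjoin (heyting_quotient H \<Theta>) A (\<Theta> `` {c}) = htop (heyting_quotient H \<Theta>)"
        using a c equiv_class_eq[OF equiv]
        by (auto simp: heyting_quotient_def quotient_op_class join_compat meet_compat)
      show "\<Theta> `` {c} \<in> hcarrier (heyting_quotient H \<Theta>)"
        using c by (simp add: heyting_quotient_def quotientI)
    qed
  qed
qed

end

section \<open>Splitting a quasiorder without closed elements\<close>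

text \<open>\<open>P\<close> encodes two disjoint sets, \<open>{x. (x, True) \<in> P}\<close> and \<open>{x. (x, False) \<in> P}\<close>,
  so that Zorn's lemma applies to plain inclusion.\<close>

definition two_colored :: "'a rel \<Rightarrow> ('a \<times> bool) set \<Rightarrow> bool" where
  "two_colored r P \<longleftrightarrow> single_valued P \<and> (\<forall>(x, b)\<in>P. \<forall>c. \<exists>y. (x, y) \<in> r \<and> (y, c) \<in> P)"

lemma two_colored_Un:
  assumes "two_colored r P" "two_colored r Q" "Domain P \<inter> Domain Q = {}"
  shows "two_colored r (P \<union> Q)"
proof -
  have "single_valued (P \<union> Q)"
    using assms unfolding two_colored_def single_valued_def by blast
  moreover have "\<exists>y. (x, y) \<in> r \<and> (y, c) \<in> P \<union> Q" if "(x, b) \<in> P \<union> Q" for x b c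
    using that assms(1,2) unfolding two_colored_def by blast
  ultimately show ?thesis
    unfolding two_colored_def by blast
qed

text \<open>Two pairs of the union lie in a common member of the chain, and the partners of a pair
  already lie in the member that contains it. The empty chain gives the empty coloring.\<close>

lemma two_colored_Union_chain:
  assumes "subset.chain {P. two_colored r P} C"
  shows "two_colored r (\<Union>C)"
  unfolding two_colored_def
proof (intro conjI)
  have sv: "single_valued P" if "P \<in> C" for P
    using assms that unfolding subset.chain_def two_colored_def by blast
  show "single_valued (\<Union>C)"
  proof (rule single_valuedI)
    fix x b c assume "(x, b) \<in> \<Union>C" "(x, c) \<in> \<Union>C"
    then obtain P Q where PQ: "P \<in> C" "Q \<in> C" "(x, b) \<in> P" "(x, c) \<in> Q"
      by blast
    then have "P \<subseteq> Q \<or> Q \<subseteq> P"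
      using assms unfolding subset.chain_def by blast
    then show "b = c"
      using PQ sv unfolding single_valued_def by blast
  qed
  show "\<forall>(x, b)\<in>\<Union>C. \<forall>c. \<exists>y. (x, y) \<in> r \<and> (y, c) \<in> \<Union>C"
    using assms unfolding subset.chain_def two_colored_def by fastforce
qed

text \<open>Either some \<open>y\<close> above \<open>x\<close> is seen by everything that it sees,
  and two points of its cluster suffice, or one can climb strictly forever from \<open>x\<close> and
  color the resulting sequence alternately.\<close>

lemma two_colored_above:
  assumes r: "preorder_on W r" and no_closed: "\<And>x. x \<in> W \<Longrightarrow> r `` {x} \<noteq> {x}" and x: "x \<in> W"
  shows "\<exists>P. two_colored r P \<and> P \<noteq> {} \<and> Domain P \<subseteq> r `` {x}"
proof (cases "\<exists>y\<in>r `` {x}. \<forall>z\<in>r `` {y}. (z, y) \<in> r")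
  case True
  then obtain y where y: "(x, y) \<in> r" "\<forall>z\<in>r `` {y}. (z, y) \<in> r" by auto
  then have "y \<in> W" "(y, y) \<in> r"
    using r unfolding preorder_on_def refl_on_def by auto
  \<comment> \<open>Since \<open>y\<close> sees itself but is not closed, it sees a second point,
    which sees \<open>y\<close> in turn by the choice of \<open>y\<close>.\<close>
  then obtain z where z: "z \<noteq> y" "(y, z) \<in> r"
    using no_closed[of y] by auto
  then have "(z, y) \<in> r" "(z, z) \<in> r" "(x, z) \<in> r"
    using y r unfolding preorder_on_def refl_on_def trans_def by blast+
  then have "two_colored r {(y, True), (z, False)}"
    using z \<open>(y, y) \<in> r\<close> unfolding two_colored_def single_valued_def
    by (auto simp: all_bool_eq)
  then show ?thesis
    using y \<open>(x, z) \<in> r\<close> by (intro exI[of _ "{(y, True), (z, False)}"]) auto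
next
  case False
  have "(x, x) \<in> r"
    using x r unfolding preorder_on_def refl_on_def by auto
  have "\<exists>f. \<forall>n. (x, f n) \<in> r \<and> ((f n, f (Suc n)) \<in> r \<and> (f (Suc n), f n) \<notin> r)"
  proof (rule dependent_nat_choice)
    show "\<exists>y. (x, y) \<in> r"
      using \<open>(x, x) \<in> r\<close> by blast
    show "\<exists>z. (x, z) \<in> r \<and> ((y, z) \<in> r \<and> (z, y) \<notin> r)" if "(x, y) \<in> r" for y
      using that False r unfolding preorder_on_def trans_def by blast
  qed
  then obtain f :: "nat \<Rightarrow> 'a"
    where "\<forall>n. (x, f n) \<in> r \<and> ((f n, f (Suc n)) \<in> r \<and> (f (Suc n), f n) \<notin> r)" ..
  then have f: "(x, f n) \<in> r" "(f n, f (Suc n)) \<in> r" "(f (Suc n), f n) \<notin> r" for n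
    by auto
  have tr: "(a, c) \<in> r" if "(a, b) \<in> r" "(b, c) \<in> r" for a b c
    using that r unfolding preorder_on_def trans_def by blast
  have mono: "(f m, f n) \<in> r" if "m \<le> n" for m n
    using that
  proof (induction n rule: dec_induct)
    case base
    show ?case using f(1)[of m] r unfolding preorder_on_def refl_on_def by blast
  next
    case (step n)
    then show ?case using f(2) tr by blast
  qed
  have inj: "m = n" if "f m = f n" for m n
  proof (rule ccontr)
    \<comment> \<open>As \<open>r\<close> need not be antisymmetric, strictness of the steps is what
      excludes a return: for \<open>m < n\<close>, \<open>f m = f n\<close> would let
      \<open>f (Suc m)\<close> see \<open>f m\<close>.\<close>
    assume "m \<noteq> n"
    then consider "Suc m \<le> n" | "Suc n \<le> m" by linarith
    then show False
      using mono f(3) that by cases metis+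
  qed
  \<comment> \<open>Injectivity of \<open>f\<close> makes the parity coloring single-valued;
    \<open>f n\<close> finds its own color at itself and the other at
    \<open>f (Suc n)\<close>.\<close>
  let ?P = "range (\<lambda>n. (f n, even n))"
  have "\<exists>y. (f n, y) \<in> r \<and> (y, c) \<in> ?P" for n c
  proof -
    have "c = even n \<or> c = even (Suc n)" by auto
    then show ?thesis
      using mono[of n n] f(2)[of n] by blast
  qed
  then have "two_colored r ?P"
    using inj unfolding two_colored_def single_valued_def by blast
  then show ?thesis
    using f(1) by (intro exI[of _ ?P]) auto
qed

lemma ex_splitting:
  assumes r: "preorder_on W r" and no_closed: "\<And>x. x \<in> W \<Longrightarrow> r `` {x} \<noteq> {x}"
  shows "\<exists>Y. \<forall>x\<in>W. r `` {x} \<inter> Y \<noteq> {} \<and> r `` {x} - Y \<noteq> {}"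
proof -
  obtain M where M: "two_colored r M" and max: "\<And>P. two_colored r P \<Longrightarrow> M \<subseteq> P \<Longrightarrow> P = M"
    using subset_Zorn'[of "{P. two_colored r P}"] two_colored_Union_chain by (metis mem_Collect_eq)
  have sees: "\<exists>y. (x, y) \<in> r \<and> (y, c) \<in> M" if x: "x \<in> W" for x c
  proof -
    \<comment> \<open>Otherwise the coloring found above \<open>x\<close> could be added to
      \<open>M\<close>, against maximality.\<close>
    have "r `` {x} \<inter> Domain M \<noteq> {}"
    proof
      assume disj: "r `` {x} \<inter> Domain M = {}"
      obtain P where P: "two_colored r P" "P \<noteq> {}" "Domain P \<subseteq> r `` {x}"
        using two_colored_above[OF r no_closed x] by blast
      then have "M \<union> P = M"
        using disj M by (intro max two_colored_Un) auto
      then have "Domain P \<subseteq> Domain M"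
        by blast
      then have "Domain P = {}"
        using P disj by blast
      then show False
        using P by auto
    qed
    then obtain y b where "(x, y) \<in> r" "(y, b) \<in> M"
      by blast
    then show ?thesis
      \<comment> \<open>The colored point \<open>y\<close> sees both colors, hence so does
        \<open>x\<close> by transitivity.\<close>
      using M r unfolding two_colored_def preorder_on_def trans_def by fastforce
  qed
  have "(y, False) \<in> M \<Longrightarrow> (y, True) \<notin> M" for y
    using M unfolding two_colored_def single_valued_def by blast
  then show ?thesis
    using sees by (intro exI[of _ "{y. (y, True) \<in> M}"]) blast
qed

section \<open>The algebra of lower approximations\<close>

lemma lower_algebra_simps [simp]:
  "hjoin (lower_algebra U R) = (\<union>)"
  "hmeet (lower_algebra U R) = (\<inter>)"
  "himp (lower_algebra U R) = (\<lambda>X Y. lower U R ((U - X) \<union> Y))"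
  "hbot (lower_algebra U R) = {}"
  "htop (lower_algebra U R) = U"
  by (simp_all add: lower_algebra_def)

text \<open>Transitivity makes lower approximations up-sets; by reflexivity an up-set is its own
  lower approximation.\<close>

lemma carrier_lower_algebra:
  assumes "preorder_on U R"
  shows "hcarrier (lower_algebra U R) = {X. X \<subseteq> U \<and> R `` X \<subseteq> X}"
proof (intro set_eqI iffI)
  fix X assume "X \<in> hcarrier (lower_algebra U R)"
  then obtain Z where "X = lower U R Z"
    by (auto simp: lower_algebra_def)
  then show "X \<in> {X. X \<subseteq> U \<and> R `` X \<subseteq> X}"
    using assms unfolding preorder_on_def trans_def lower_def by blast
next
  fix X assume "X \<in> {X. X \<subseteq> U \<and> R `` X \<subseteq> X}"
  then have "X = lower U R X" "X \<subseteq> U"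
    using assms unfolding preorder_on_def refl_on_def lower_def by blast+
  then show "X \<in> hcarrier (lower_algebra U R)"
    by (auto simp: lower_algebra_def)
qed

lemma lower_in_carrier:
  assumes "preorder_on U R"
  shows "lower U R X \<in> hcarrier (lower_algebra U R)"
  using assms unfolding carrier_lower_algebra[OF assms] preorder_on_def trans_def lower_def
  by blast

lemma heyting_alg_lower_algebra:
  assumes "preorder_on U R"
  shows "heyting_alg (lower_algebra U R)"
proof unfold_locales
  fix a b c
  assume "a \<in> hcarrier (lower_algebra U R)" "b \<in> hcarrier (lower_algebra U R)"
    "c \<in> hcarrier (lower_algebra U R)"
  moreover have "x \<in> R `` {x}" if "x \<in> U" for x
    using assms that unfolding preorder_on_def refl_on_def by blast
  moreover have "R `` {x} \<subseteq> U" for x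
    using assms unfolding preorder_on_def by blast
  ultimately have "c \<subseteq> lower U R ((U - a) \<union> b) \<longleftrightarrow> c \<inter> a \<subseteq> b"
    unfolding carrier_lower_algebra[OF assms] lower_def by blast
  then show "hle (lower_algebra U R) c (himp (lower_algebra U R) a b) \<longleftrightarrow>
      hle (lower_algebra U R) (hmeet (lower_algebra U R) c a) b"
    by (auto simp: hle_def)
qed (use assms in \<open>auto simp: hle_def lower_in_carrier\<close>,
     auto simp: carrier_lower_algebra preorder_on_def)

section \<open>Restriction to closed elements as a Boolean congruence\<close>

lemma mem_lower_closed_iff:
  assumes "x \<in> closed_elems U R"
  shows "x \<in> lower U R Z \<longleftrightarrow> x \<in> Z"
  using assms by (simp add: lower_def closed_elems_def)

text \<open>Intersecting with \<open>S\<close> is a homomorphism into the power set of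
  \<open>S\<close>: \<open>lower\<close> changes nothing at closed elements, so \<open>himp\<close>
  restricts to classical implication.\<close>

lemma heyting_congruence_cong_on:
  assumes "preorder_on U R" "S \<subseteq> closed_elems U R"
  shows "heyting_congruence (lower_algebra U R) (cong_on U R S)"
proof -
  interpret heyting_alg "lower_algebra U R"
    using assms(1) by (rule heyting_alg_lower_algebra)
  show ?thesis
  proof unfold_locales
    show "equiv (hcarrier (lower_algebra U R)) (cong_on U R S)"
      by (auto simp: cong_on_def equiv_def refl_on_def sym_def trans_def)
    fix a a' b b' assume ab: "(a, a') \<in> cong_on U R S" "(b, b') \<in> cong_on U R S"
    show "(hjoin (lower_algebra U R) a b, hjoin (lower_algebra U R) a' b') \<in> cong_on U R S"
      "(hmeet (lower_algebra U R) a b, hmeet (lower_algebra U R) a' b') \<in> cong_on U R S"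
      using ab join_closed meet_closed by (auto simp: cong_on_def)
    have "lower U R Z \<inter> S = Z \<inter> S" for Z
      using assms(2) by (auto simp: mem_lower_closed_iff subset_iff)
    then show "(himp (lower_algebra U R) a b, himp (lower_algebra U R) a' b') \<in> cong_on U R S"
      using ab lower_in_carrier[OF assms(1)] by (auto simp: cong_on_def)
  qed
qed

lemma boolean_congruence_cong_on:
  assumes "preorder_on U R" "S \<subseteq> closed_elems U R"
  shows "boolean_congruence (lower_algebra U R) (cong_on U R S)"
proof (rule heyting_congruence.boolean_congruenceI)
  show "heyting_congruence (lower_algebra U R) (cong_on U R S)"
    using assms by (rule heyting_congruence_cong_on)
  interpret heyting_alg "lower_algebra U R"
    using assms(1) by (rule heyting_alg_lower_algebra)
  fix a assume a: "a \<in> hcarrier (lower_algebra U R)"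
  \<comment> \<open>The pseudocomplement of \<open>a\<close>; on \<open>S\<close> it is the true
    complement.\<close>
  let ?c = "lower U R (U - a)"
  have c: "?c \<in> hcarrier (lower_algebra U R)"
    using assms(1) by (rule lower_in_carrier)
  have "S \<subseteq> U"
    using assms(2) by (auto simp: closed_elems_def)
  moreover have "?c \<inter> S = S - a"
    using assms(2) \<open>S \<subseteq> U\<close> by (auto simp: mem_lower_closed_iff subset_iff)
  ultimately have "(a \<inter> ?c, {}) \<in> cong_on U R S" "(a \<union> ?c, U) \<in> cong_on U R S"
    using a c bot_closed top_closed join_closed[OF a c] meet_closed[OF a c]
    by (auto simp: cong_on_def)
  then show "\<exists>c\<in>hcarrier (lower_algebra U R).
      (hmeet (lower_algebra U R) a c, hbot (lower_algebra U R)) \<in> cong_on U R S \<and>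
      (hjoin (lower_algebra U R) a c, htop (lower_algebra U R)) \<in> cong_on U R S"
    using c by auto
qed

section \<open>Rough sets as Sendlewski pairs\<close>

lemma mem_sendlewski_cong_on_iff:
  assumes "preorder_on U R" "S \<subseteq> U"
  shows "(A, B) \<in> sendlewski (lower_algebra U R) (cong_on U R S) \<longleftrightarrow>
    A \<subseteq> U \<and> R `` A \<subseteq> A \<and> B \<subseteq> U \<and> R `` B \<subseteq> B \<and> A \<inter> B = {} \<and> S \<subseteq> A \<union> B"
  using assms unfolding sendlewski_def cong_on_def carrier_lower_algebra[OF assms(1)] preorder_on_def
  by auto

lemma Diff_upper:
  assumes "R \<subseteq> U \<times> U"
  shows "U - upper U R X = lower U R (U - X)"
  using assms by (auto simp: lower_def upper_def)

lemma ex_rough_set: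
  assumes R: "preorder_on U R"
    and A: "A \<subseteq> U" "R `` A \<subseteq> A" and B: "B \<subseteq> U" "R `` B \<subseteq> B"
    and disj: "A \<inter> B = {}" and cover: "closed_elems U R \<subseteq> A \<union> B"
  shows "\<exists>X\<subseteq>U. A = lower U R X \<and> B = lower U R (U - X)"
proof -
  have refl: "(x, x) \<in> R" if "x \<in> U" for x
    using R that unfolding preorder_on_def refl_on_def by blast
  have tr: "(x, z) \<in> R" if "(x, y) \<in> R" "(y, z) \<in> R" for x y z
    using R that unfolding preorder_on_def trans_def by blast
  have RU: "R \<subseteq> U \<times> U"
    using R unfolding preorder_on_def by blast
  \<comment> \<open>By reflexivity \<open>V\<close> misses \<open>A\<close> and \<open>B\<close>,
    and hence all closed elements by \<open>cover\<close>; by transitivity it is an up-set, so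
    restricting \<open>R\<close> to it loses no successors.\<close>
  define V where "V = {x \<in> U. R `` {x} \<inter> (A \<union> B) = {}}"
  have up: "y \<in> V" if "x \<in> V" "(x, y) \<in> R" for x y
    using that RU tr unfolding V_def by blast
  define r where "r = R \<inter> V \<times> V"
  have r_image: "r `` {x} = R `` {x}" if "x \<in> V" for x
    using that up unfolding r_def by blast
  have "preorder_on V r"
    unfolding preorder_on_def
  proof (intro conjI)
    show "r \<subseteq> V \<times> V"
      by (simp add: r_def)
    show "refl_on V r"
      using refl by (simp add: refl_on_def r_def V_def)
    show "trans r"
      using tr unfolding trans_def r_def by blast
  qed
  moreover have "r `` {x} \<noteq> {x}" if "x \<in> V" for x
  proof -
    have "x \<in> U" "x \<notin> A \<union> B"
      using that refl unfolding V_def by auto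
    then show ?thesis
      using cover r_image[OF that] by (auto simp: closed_elems_def)
  qed
  ultimately obtain Y0 where Y0: "\<forall>x\<in>V. r `` {x} \<inter> Y0 \<noteq> {} \<and> r `` {x} - Y0 \<noteq> {}"
    using ex_splitting[of V r] by blast
  \<comment> \<open>\<open>Y0\<close> is unconstrained outside \<open>V\<close>, hence the
    intersection. Elements of \<open>B\<close> would satisfy the last condition too, hence
    \<open>U - B\<close>.\<close>
  define X where
    "X = A \<union> (V \<inter> Y0) \<union> {x \<in> U - B. R `` {x} \<inter> A = {} \<and> R `` {x} \<inter> B \<noteq> {}}"
  have XU: "X \<subseteq> U"
    using A unfolding X_def V_def by blast
  have AX: "A \<subseteq> X" and BX: "B \<inter> X = {}"
    using disj refl B unfolding X_def V_def by blast+
  have V_X: "R `` {x} \<inter> X \<noteq> {} \<and> R `` {x} - X \<noteq> {}" if "x \<in> V" for x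
  proof -
    \<comment> \<open>The other two parts of \<open>X\<close> consist of elements that see
      \<open>A\<close> or \<open>B\<close>, so they miss \<open>V\<close>.\<close>
    have "X \<inter> V = Y0 \<inter> V"
      using refl A unfolding X_def V_def by blast
    moreover have "R `` {x} \<subseteq> V"
      using that up by blast
    ultimately show ?thesis
      using Y0 that r_image[OF that] by blast
  qed
  \<comment> \<open>Such an \<open>x\<close> may also see \<open>B\<close>. It sees itself outside
    \<open>X\<close> and a point of \<open>A\<close> inside.\<close>
  have A_only: "x \<notin> X" if "x \<in> U - A" "R `` {x} \<inter> A \<noteq> {}" for x
    using that unfolding X_def V_def by blast
  have B_only: "x \<in> X" if "x \<in> U - B" "R `` {x} \<inter> A = {}" "R `` {x} \<inter> B \<noteq> {}" for x
    using that unfolding X_def by blast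
  \<comment> \<open>This keeps both lower approximations from growing beyond \<open>A\<close> and
    \<open>B\<close>. Outside \<open>V\<close>, one of the two required points is \<open>x\<close>
    itself.\<close>
  have mixed: "R `` {x} \<inter> X \<noteq> {} \<and> R `` {x} - X \<noteq> {}" if x: "x \<in> U" "x \<notin> A" "x \<notin> B" for x
  proof (cases "R `` {x} \<inter> A = {}")
    case True
    show ?thesis
    proof (cases "R `` {x} \<inter> B = {}")
      case True
      then show ?thesis using V_X[of x] \<open>R `` {x} \<inter> A = {}\<close> x unfolding V_def by blast
    next
      case False
      then show ?thesis using B_only[of x] BX True x refl by blast
    qed
  next
    case False
    then show ?thesis using A_only[of x] AX x refl by blast
  qed
  have "A = lower U R X"
  proof (intro set_eqI iffI)
    show "x \<in> lower U R X" if "x \<in> A" for x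
      using that A AX unfolding lower_def by blast
    show "x \<in> A" if "x \<in> lower U R X" for x
    proof -
      have x: "x \<in> U" "R `` {x} \<subseteq> X"
        using that by (auto simp: lower_def)
      then have "x \<in> X"
        using refl by blast
      then show ?thesis
        using x BX mixed by blast
    qed
  qed
  moreover have "B = lower U R (U - X)"
  proof (intro set_eqI iffI)
    show "x \<in> lower U R (U - X)" if "x \<in> B" for x
      using that B BX unfolding lower_def by blast
    show "x \<in> B" if "x \<in> lower U R (U - X)" for x
    proof -
      have x: "x \<in> U" "R `` {x} \<inter> X = {}"
        using that by (auto simp: lower_def)
      then have "x \<notin> A"
        using refl AX by blast
      then show ?thesis
        using x mixed by blast
    qed
  qed
  ultimately show ?thesis
    using XU by blast
qed

lemma DRS_eq_sendlewski:
  assumes R: "preorder_on U R"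
  shows "DRS U R = sendlewski (lower_algebra U R) (cong_on U R (closed_elems U R))"
    (is "_ = ?N")
proof -
  have S: "closed_elems U R \<subseteq> U"
    by (auto simp: closed_elems_def)
  have RU: "R \<subseteq> U \<times> U"
    using R unfolding preorder_on_def by blast
  have "(lower U R X, lower U R (U - X)) \<in> ?N" if "X \<subseteq> U" for X
  proof -
    have "lower U R X \<inter> lower U R (U - X) = {}"
      using R unfolding preorder_on_def refl_on_def lower_def by blast
    \<comment> \<open>A closed element sees only itself, so it falls on one side according to
      whether it lies in \<open>X\<close>.\<close>
    moreover have "closed_elems U R \<subseteq> lower U R X \<union> lower U R (U - X)"
      using S by (auto simp: mem_lower_closed_iff)
    ultimately show ?thesis
      using lower_in_carrier[OF R]
      by (simp add: mem_sendlewski_cong_on_iff[OF R S] carrier_lower_algebra[OF R])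
  qed
  then have "{(lower U R X, lower U R (U - X)) | X. X \<subseteq> U} \<subseteq> ?N"
    by auto
  moreover have "?N \<subseteq> {(lower U R X, lower U R (U - X)) | X. X \<subseteq> U}"
  proof (rule subrelI)
    fix A B assume "(A, B) \<in> ?N"
    then have "\<exists>X\<subseteq>U. A = lower U R X \<and> B = lower U R (U - X)"
      by (intro ex_rough_set[OF R]) (simp_all add: mem_sendlewski_cong_on_iff[OF R S])
    then show "(A, B) \<in> {(lower U R X, lower U R (U - X)) | X. X \<subseteq> U}"
      by auto
  qed
  ultimately show ?thesis
    by (simp add: DRS_def Diff_upper[OF RU] subset_antisym)
qed

theorem mainTheorem5:
  fixes U :: "'a set" and R :: "'a rel" and S :: "'a set"
  assumes "preorder_on U R"
    and "S = closed_elems U R"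
  shows "boolean_congruence (lower_algebra U R) (cong_on U R S) \<and>
    DRS U R = sendlewski (lower_algebra U R) (cong_on U R S)"
  using assms boolean_congruence_cong_on DRS_eq_sendlewski by blast

end
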